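(* Let $n\geq 1$, $k\in\{4,5,6\}$, $a=2[n,n+1,\ldots,n+k]$, and $b=L_nL_{n+1}\cdots L_{n+k}$. Then: (i) If $k=4$, then $z(b)=3a$ if $n\equiv 2,14,18,30\pmod{36}$, and $z(b)=a$ otherwise. (ii) If $k=5$, then $z(b)=3a$ if $n\equiv 1,2,13,14,17,18,29,30\pmod{36}$, and $z(b)=a$ otherwise. (iii) If $k=6$, then $z(b)=3a$ if $n\equiv 1,2,12,13,14,16,17,18,28,29\pmod{36}$, and $z(b)=a$ otherwise.
   Context: $F_n$ is the $n$th Fibonacci number ($F_1=F_2=1$, $F_n=F_{n-1}+F_{n-2}$) and $L_n$ the $n$th Lucas number ($L_1=1$, $L_2=3$, $L_n=L_{n-1}+L_{n-2}$). For a positive integer $m$, $z(m)$ is the smallest positive integer $k$ with $m\mid F_k$. $[\cdots]$ denotes lcm. *)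

theory Defs
  imports "HOL-Number_Theory.Number_Theory"
begin

text \<open>The Lucas numbers, extended to index 0 by the recurrence, so that
  \<open>lucas 1 = 1\<close> and \<open>lucas 2 = 3\<close>.\<close>

fun lucas :: "nat \<Rightarrow> nat" where
  "lucas 0 = 2"
| "lucas (Suc 0) = 1"
| "lucas (Suc (Suc n)) = lucas (Suc n) + lucas n"

text \<open>The order of appearance of \<open>m\<close> in the Fibonacci sequence; some \<open>k\<close> as required exists
  for every positive \<open>m\<close>.\<close>

definition fib_appearance :: "nat \<Rightarrow> nat" where
  "fib_appearance m = (LEAST k. 0 < k \<and> m dvd fib k)"

end

theory Submission
  imports Defs
begin

text \<open>
  A prime dividing two of the Lucas numbers \<open>L\<^sub>n, \<dots>, L\<^bsub>n+6\<^esub>\<close> is 2 or 3, and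
  \<open>L\<^sub>i\<close> divides \<open>F\<^sub>m\<close> iff \<open>2i\<close> divides \<open>m\<close> (for \<open>i \<ge> 2\<close>). So \<open>z(b)\<close> is a multiple of \<open>a\<close>, and
  whether \<open>b\<close> divides \<open>F\<^sub>m\<close> for a multiple \<open>m\<close> of \<open>a\<close> depends on the primes 2 and 3 only.
  The prime 2 is harmless, since \<open>32\<close> divides \<open>F\<^bsub>24\<^esub>\<close> and 24 divides \<open>a\<close>. For the prime 3,
  \<open>v\<^sub>3(F\<^sub>m) = 1 + v\<^sub>3(m)\<close> if \<open>4\<close> divides \<open>m\<close>, and \<open>v\<^sub>3(L\<^sub>i) = 1 + v\<^sub>3(i)\<close> if
  \<open>i \<equiv> 2 (mod 4)\<close> and 0 otherwise. Hence \<open>v\<^sub>3(b)\<close> exceeds \<open>v\<^sub>3(F\<^sub>a)\<close>, and then by exactly 1,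
  iff there are two indices \<open>i \<equiv> 2 (mod 4)\<close> and the maximum of \<open>v\<^sub>3\<close> over all indices is attained
  at one of them. As at most one index is divisible by 9, this depends on \<open>n\<close> modulo 36 only.
\<close>

section \<open>Identities linking Fibonacci and Lucas numbers\<close>

lemma lucas_eq_fib: "lucas n + fib n = 2 * fib (Suc n)"
  by (induction n rule: lucas.induct) auto

lemma lucas_numerals:
  "lucas 2 = 3" "lucas 3 = 4" "lucas 4 = 7" "lucas 5 = 11" "lucas 6 = 18" "lucas 7 = 29"
  "lucas 8 = 47" "lucas 9 = 76" "lucas 10 = 123" "lucas 11 = 199"
  by (simp_all add: numeral_eq_Suc)

lemma lucas_gt_fib: "n \<noteq> 1 \<Longrightarrow> fib n < lucas n"
  using lucas_eq_fib[of n] by (cases n) (auto simp: fib_neq_0_nat)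

lemma lucas_neq_0 [simp]: "lucas n \<noteq> 0"
  by (induction n rule: lucas.induct) auto

lemma fib_double: "fib (2 * n) = fib n * lucas n"
proof (cases n)
  case (Suc m)
  have "lucas n = fib (n - 1) + fib (n + 1)"
    using lucas_eq_fib[of n] by (simp add: Suc)
  then show ?thesis
    by (simp add: fib_rec_even)
qed simp

lemma lucas_add: "lucas (Suc (m + n)) = fib (Suc n) * lucas (Suc m) + fib n * lucas m"
  by (induction n rule: fib.induct) (auto simp: algebra_simps)

lemma two_lucas_add: "2 * lucas (m + n) = lucas m * lucas n + 5 * fib m * fib n"
proof (induction n rule: lucas.induct)
  case 2
  show ?case
    by (induction m rule: lucas.induct) auto
qed (auto simp: algebra_simps)

lemma lucas_square_int: "(int (lucas n))\<^sup>2 = 5 * (int (fib n))\<^sup>2 + 4 * (- 1) ^ n"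
proof (cases n)
  case (Suc m)
  have "lucas n = fib m + fib (Suc (Suc m))"
    using lucas_eq_fib[of n] by (simp add: Suc)
  \<comment> \<open>Sum and difference of F_{n+1} and F_{n-1} are L_n and F_n, so their squares
    differ by four times the product, which Cassini evaluates.\<close>
  then have "(int (lucas n))\<^sup>2 = (int (fib n))\<^sup>2 + 4 * int (fib (Suc (Suc m)) * fib m)"
    by (simp add: Suc power2_eq_square algebra_simps)
  then show ?thesis
    using fib_Cassini_int[of m] by (simp add: Suc)
qed auto

lemma fib_numerals:
  "fib 3 = 2" "fib 4 = 3" "fib 5 = 5" "fib 6 = 8" "fib 11 = 89" "fib 12 = 144" "fib 24 = 46368"
  by (simp_all add: fib_rec[of "numeral w" for w] Let_def power2_eq_square)

section \<open>Divisibility between Lucas and Fibonacci numbers\<close>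

lemma fib_dvd: "m dvd n \<Longrightarrow> fib m dvd fib n"
  by (metis fib_gcd gcd_nat.absorb_iff1)

lemma dvd_fib_gcd: "d dvd fib m \<Longrightarrow> d dvd fib n \<Longrightarrow> d dvd fib (gcd m n)"
  by (simp add: fib_gcd)

lemma lucas_dvd_fib_double: "lucas n dvd fib (2 * n)"
  by (simp add: fib_double)

text \<open>With g = gcd(m, 2n), L_n divides F_g, so F_g \<ge> L_n > F_n and g > n; a divisor of 2n
  above n is 2n itself. Index 1 fails because L_1 = 1.\<close>

lemma double_dvd_if_lucas_dvd_fib:
  assumes "2 \<le> n" "lucas n dvd fib m"
  shows "2 * n dvd m"
proof -
  define g where "g = gcd m (2 * n)"
  have "lucas n dvd fib g"
    unfolding g_def using assms(2) lucas_dvd_fib_double by (rule dvd_fib_gcd)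
  moreover have "0 < g"
    using assms(1) by (simp add: g_def)
  ultimately have "lucas n \<le> fib g"
    by (simp add: dvd_imp_le fib_neq_0_nat)
  moreover have "fib n < lucas n"
    using assms(1) by (simp add: lucas_gt_fib)
  ultimately have "n < g"
    using fib_mono[of g n] by linarith
  moreover obtain c where c: "2 * n = g * c"
    using gcd_dvd2[of m "2 * n"] unfolding g_def by blast
  ultimately have "c < 2"
    using mult_le_mono[of "Suc n" g 2 c] by (auto simp: not_le[symmetric])
  with c assms(1) have "g = 2 * n"
    by (cases c) auto
  then show ?thesis
    by (metis g_def gcd_dvd1)
qed

text \<open>By \<open>two_lucas_add\<close>, p divides 5 F_m or F_e. In the first case L_m^2 - 5
  F_m^2 = \<plusminus>4 forces p = 2; in the second, F_e is one of 1, 2, 3, 5, 8.\<close>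

lemma prime_dvd_two_lucas:
  assumes "prime p" "p dvd lucas m" "p dvd lucas (m + e)" "0 < e" "e \<le> 6"
  shows "p \<in> {2, 3}"
proof -
  have two: "p = 2" if "p dvd 5 * fib m"
  proof -
    have "int p dvd (int (lucas m))\<^sup>2 - 5 * (int (fib m))\<^sup>2"
    proof (rule dvd_diff)
      show "int p dvd (int (lucas m))\<^sup>2"
        using assms(2) by (simp add: power2_eq_square)
      have "int p dvd int (5 * fib m)"
        using that by (simp only: of_nat_dvd_iff)
      then show "int p dvd 5 * (int (fib m))\<^sup>2"
        by (simp add: power2_eq_square mult.assoc[symmetric])
    qed
    then have "int p dvd int (2 ^ 2)"
      by (cases "even m") (simp_all add: lucas_square_int)
    then have "p dvd 2 ^ 2"
      by (simp only: of_nat_dvd_iff)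
    then have "p dvd 2"
      using assms(1) prime_dvd_power by blast
    then show ?thesis
      using assms(1) primes_dvd_imp_eq two_is_prime_nat by blast
  qed
  have "p dvd lucas m * lucas e + 5 * fib m * fib e"
    using assms(3) by (simp flip: two_lucas_add)
  then have "p dvd 5 * fib m * fib e"
    using assms(2) by (simp add: dvd_add_right_iff)
  then consider "p dvd 5 * fib m" | "p dvd fib e"
    using assms(1) by (auto simp: prime_dvd_mult_iff)
  then show ?thesis
  proof cases
    case 1
    then show ?thesis using two by blast
  next
    case 2
    have "e \<in> {1, 2, 3, 4, 5, 6}"
      using assms(4,5) by auto
    then have "fib e \<in> {1, 2, 3, 5, 2 ^ 3}"
      by (auto simp: fib_numerals)
    with 2 have "p dvd 1 \<or> p dvd 2 \<or> p dvd 3 \<or> p dvd 5"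
      using assms(1) prime_dvd_power[of p 2 3] by auto
    moreover have "p = q" if "p dvd q" "prime q" for q
      using assms(1) that primes_dvd_imp_eq by blast
    moreover have "prime (3 :: nat)" "prime (5 :: nat)"
      by (simp_all add: prime_nat_numeral_eq)
    \<comment> \<open>The value 5 is excluded by \<open>two\<close>, since 5 divides 5 F_m.\<close>
    ultimately have "p \<in> {2, 3} \<or> p = 5"
      using assms(1) two_is_prime_nat by auto
    then show ?thesis
      using two by auto
  qed
qed

section \<open>3-adic valuations of Fibonacci and Lucas numbers\<close>

lemma three_dvd_fib_iff: "3 dvd fib n \<longleftrightarrow> 4 dvd n"
proof
  have *: "3 dvd fib 4"
    by (simp add: fib_numerals)
  then show "4 dvd n \<Longrightarrow> 3 dvd fib n"
    using fib_dvd dvd_trans by blast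
  assume "3 dvd fib n"
  then have dvd: "3 dvd fib (gcd n 4)"
    using * by (rule dvd_fib_gcd)
  have "gcd n 4 \<le> 4"
    by (rule gcd_le2_nat) simp
  then consider "gcd n 4 = 0" | "gcd n 4 = 1" | "gcd n 4 = 2" | "gcd n 4 = 3" | "gcd n 4 = 4"
    by linarith
  then have "gcd n 4 = 4"
    using dvd by cases (simp_all add: fib_numerals)
  then show "4 dvd n"
    by (metis gcd_dvd1)
qed

lemma prime_elem_3: "prime_elem (3 :: nat)"
  by (simp add: prime_nat_numeral_eq)

lemma multiplicity_3_double: "multiplicity 3 (2 * n) = multiplicity 3 (n :: nat)"
  by (rule multiplicity_prime_elem_times_other) (auto simp: prime_elem_3)

text \<open>With F_n = 3w and u = F_{n-1}, the addition formulas give F_{3n} = 3 F_n (6w^2 + u^2 +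
  3uw). The bracket is u^2 modulo 3, and 3 does not divide u because consecutive Fibonacci numbers
  are coprime.\<close>

lemma multiplicity_3_fib_triple:
  assumes "0 < n" "3 dvd fib n"
  shows "multiplicity 3 (fib (3 * n)) = Suc (multiplicity 3 (fib n))"
proof -
  obtain m where n: "n = Suc m"
    using assms(1) gr0_conv_Suc by blast
  obtain w where w: "fib n = 3 * w"
    using assms(2) by blast
  define u where "u = fib m"
  have Suc_n: "fib (Suc n) = fib n + u"
    by (simp add: n u_def)
  have "lucas n = fib n + 2 * u"
    using lucas_eq_fib[of n] by (simp add: Suc_n)
  then have double: "fib (2 * n) = fib n * (fib n + 2 * u)"
    by (simp add: fib_double)
  have "3 * n = Suc (m + 2 * n)"
    by (simp add: n)
  then have "fib (3 * n) = fib (Suc (m + 2 * n))"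
    by (rule arg_cong)
  also have "\<dots> = fib (Suc (2 * n)) * fib n + fib (2 * n) * u"
    by (simp only: fib_add n u_def)
  also have "\<dots> = 3 * (fib n * (6 * w\<^sup>2 + u\<^sup>2 + 3 * u * w))"
    unfolding fib_rec_odd double Suc_n w by (simp add: algebra_simps power2_eq_square)
  finally have eq: "fib (3 * n) = 3 * (fib n * (6 * w\<^sup>2 + u\<^sup>2 + 3 * u * w))" .
  have "\<not> 3 dvd u"
    using coprime_fib_Suc_nat[of m] assms(2) unfolding u_def n
    by (metis coprime_common_divisor_nat numeral_eq_one_iff semiring_norm(86))
  then have "\<not> 3 dvd u\<^sup>2"
    using prime_dvd_power[of "3 :: nat" u 2] by (auto simp: prime_nat_numeral_eq)
  moreover have "6 * w\<^sup>2 + u\<^sup>2 + 3 * u * w = u\<^sup>2 + 3 * (2 * w\<^sup>2 + u * w)"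
    by simp
  ultimately have not_dvd: "\<not> 3 dvd 6 * w\<^sup>2 + u\<^sup>2 + 3 * u * w"
    by (metis dvd_add_left_iff dvd_triv_left)
  then have "6 * w\<^sup>2 + u\<^sup>2 + 3 * u * w \<noteq> 0"
    by (metis dvd_0_right)
  moreover have "fib n \<noteq> 0"
    using assms(1) fib_neq_0_nat by simp
  ultimately show ?thesis
    using not_dvd prime_elem_3 unfolding eq
    by (simp add: multiplicity_times_same prime_elem_multiplicity_mult_distrib
        not_dvd_imp_multiplicity_0)
qed

text \<open>Factors 3 of m are stripped one at a time by the tripling lemma, until m is prime to
  3.\<close>

lemma multiplicity_3_fib:
  assumes "0 < m"
  shows "multiplicity 3 (fib (4 * m)) = Suc (multiplicity 3 m)"
  using assms
proof (induction m rule: less_induct)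
  case (less m)
  show ?case
  proof (cases "3 dvd m")
    case True
    then obtain l where l: "m = 3 * l" by blast
    have "multiplicity 3 (fib (3 * (4 * l))) = Suc (multiplicity 3 (fib (4 * l)))"
      using less.prems l by (intro multiplicity_3_fib_triple) (auto simp: three_dvd_fib_iff)
    then show ?thesis
      using less l by (simp add: multiplicity_times_same mult.left_commute)
  next
    case False
    have "\<not> 9 dvd fib (4 * m)"
    proof
      assume "9 dvd fib (4 * m)"
      \<comment> \<open>F_12 = 144; as gcd(4m, 12) = 4, a factor 9 of F_{4m} would pass to F_4 =
        3.\<close>
      moreover have "9 dvd fib (4 * 3)"
        by (simp add: fib_numerals)
      ultimately have "9 dvd fib (gcd (4 * m) (4 * 3))"
        by (rule dvd_fib_gcd)
      moreover have "gcd m 3 = 1"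
        using False prime_elem_3 prime_elem_imp_coprime
        by (metis coprime_imp_gcd_eq_1 gcd.commute)
      ultimately have "9 dvd fib 4"
        by (metis gcd_mult_distrib_nat mult.right_neutral)
      then show False
        by (simp add: fib_numerals)
    qed
    moreover have "3 dvd fib (4 * m)"
      by (simp add: three_dvd_fib_iff)
    ultimately have "multiplicity 3 (fib (4 * m)) = 1"
      by (intro multiplicity_eqI) auto
    then show ?thesis
      using False by (simp add: not_dvd_imp_multiplicity_0)
  qed
qed

text \<open>Since F_{2n} = F_n L_n, the valuation is the difference of those of F_{2n} and F_n: they
  agree if 4 divides n, only F_{2n} contributes if n \<equiv> 2 (mod 4), and neither does for odd
  n.\<close>

lemma multiplicity_3_lucas:
  assumes "0 < n"
  shows "multiplicity 3 (lucas n) = (if n mod 4 = 2 then Suc (multiplicity 3 n) else 0)"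
proof -
  have double: "multiplicity 3 (fib (2 * n)) = multiplicity 3 (fib n) + multiplicity 3 (lucas n)"
    using assms fib_neq_0_nat[of n]
    by (simp add: fib_double prime_elem_multiplicity_mult_distrib prime_elem_3)
  have "4 dvd n \<or> n mod 4 = 2 \<or> odd n"
    by presburger
  then consider "4 dvd n" | "n mod 4 = 2" | "odd n"
    by blast
  then show ?thesis
  proof cases
    case 1
    then obtain m where "n = 4 * m" by blast
    with 1 double multiplicity_3_double[of m] assms show ?thesis
      using multiplicity_3_fib[of m] multiplicity_3_fib[of "2 * m"] by simp
  next
    case 2
    define m where "m = n div 2"
    have m: "n = 2 * m" "\<not> 4 dvd n"
      using 2 unfolding m_def by presburger+
    with 2 double multiplicity_3_double[of m] assms show ?thesis
      using multiplicity_3_fib[of m] by (simp add: three_dvd_fib_iff not_dvd_imp_multiplicity_0)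
  next
    case 3
    then have "\<not> 4 dvd 2 * n" "n mod 4 \<noteq> 2" by presburger+
    with double show ?thesis
      by (simp add: three_dvd_fib_iff not_dvd_imp_multiplicity_0)
  qed
qed

section \<open>2-adic valuation of Lucas numbers\<close>

lemma lucas_mod_8: "lucas n mod 8 = lucas (n mod 12) mod 8"
proof (induction n rule: less_induct)
  case (less n)
  show ?case
  proof (cases "n < 12")
    case False
    define m where "m = n - 12"
    have n: "n = m + 12"
      using False by (simp add: m_def)
    \<comment> \<open>The coefficients are F_12 = 144 = 8 * 18 and F_11 = 89 = 8 * 11 + 1, which
      gives the period 12.\<close>
    have "lucas n = 8 * (18 * lucas (Suc m) + 11 * lucas m) + lucas m"
      using lucas_add[of m 11] by (simp add: n fib_numerals add.commute)
    then have "lucas n mod 8 = lucas m mod 8"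
      by (metis mod_mult_self4)
    then show ?thesis
      using less.IH[of m] by (simp add: n)
  qed simp
qed

text \<open>The bounds are at most 2, so the residue modulo 8 = 2^3 decides, and one period can be
  inspected.\<close>

lemma multiplicity_2_lucas_le:
  "multiplicity 2 (lucas n) \<le> (if n mod 6 = 3 then 2 else if n mod 6 = 0 then 1 else 0)"
  (is "_ \<le> ?g n")
proof -
  have "n mod 12 = 0 \<or> n mod 12 = 1 \<or> n mod 12 = 2 \<or> n mod 12 = 3
    \<or> n mod 12 = 4 \<or> n mod 12 = 5 \<or> n mod 12 = 6 \<or> n mod 12 = 7
    \<or> n mod 12 = 8 \<or> n mod 12 = 9 \<or> n mod 12 = 10 \<or> n mod 12 = 11"
    by presburger
  moreover have "n mod 6 = n mod 12 mod 6"
    by (simp add: mod_mod_cancel)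
  ultimately have "\<not> 2 ^ Suc (?g n) dvd lucas (n mod 12) mod 8"
    by (elim disjE) (simp_all add: lucas_numerals)
  moreover have "2 ^ Suc (?g n) dvd (8 :: nat)"
    by auto
  ultimately have "\<not> 2 ^ Suc (?g n) dvd lucas n"
    by (metis lucas_mod_8 dvd_mod)
  then have "multiplicity 2 (lucas n) < Suc (?g n)"
    by (intro multiplicity_lessI) simp_all
  then show ?thesis
    by (simp only: less_Suc_eq_le)
qed

section \<open>Valuations of lcms and of products of Lucas numbers\<close>

lemma multiplicity_lcm:
  fixes x y :: nat
  assumes "prime p" "x \<noteq> 0" "y \<noteq> 0"
  shows "multiplicity p (lcm x y) = max (multiplicity p x) (multiplicity p y)"
  using assms by (simp add: prime_factorization_lcm flip: count_prime_factorization_prime)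

lemma multiplicity_Lcm:
  fixes A :: "nat set"
  assumes "prime p" "finite A" "A \<noteq> {}" "0 \<notin> A"
  shows "multiplicity p (Lcm A) = Max (multiplicity p ` A)"
  using assms(2-4)
proof (induction A rule: finite_ne_induct)
  case (insert x A)
  then show ?case
    using assms(1) by (simp add: multiplicity_lcm Lcm_0_iff_nat)
qed simp

lemma multiplicity_3_prod_lucas:
  assumes "0 \<notin> A" "finite A"
  shows "multiplicity 3 (\<Prod>x\<in>A. lucas x)
    = (\<Sum>x\<in>A. if x mod 4 = 2 then Suc (multiplicity 3 x) else 0)"
proof -
  have "multiplicity 3 (\<Prod>x\<in>A. lucas x) = (\<Sum>x\<in>A. multiplicity 3 (lucas x))"
    using assms(2) by (intro prime_elem_multiplicity_prod_distrib) (auto simp: prime_elem_3)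
  also have "\<dots> = (\<Sum>x\<in>A. if x mod 4 = 2 then Suc (multiplicity 3 x) else 0)"
    using assms(1) by (intro sum.cong refl multiplicity_3_lucas) (metis gr0I)
  finally show ?thesis .
qed

lemma atLeastAtMost_add_6:
  fixes n :: nat
  shows "{n..n + 6} = {n, n + 1, n + 2, n + 3, n + 4, n + 5, n + 6}"
  by auto

text \<open>Multiples of 3 contribute 2 and 1 alternately, and seven consecutive indices contain at
  most three of them: the worst case is 2 + 1 + 2.\<close>

lemma multiplicity_2_prod_lucas_le:
  assumes "k \<le> 6"
  shows "multiplicity 2 (\<Prod>i = n..n + k. lucas i) \<le> 5"
proof -
  let ?g = "\<lambda>x :: nat. if x mod 6 = 3 then 2 else if x mod 6 = 0 then 1 else 0 :: nat"
  have "multiplicity 2 (\<Prod>i = n..n + k. lucas i) = (\<Sum>i = n..n + k. multiplicity 2 (lucas i))"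
    by (intro prime_elem_multiplicity_prod_distrib) auto
  also have "\<dots> \<le> (\<Sum>i = n..n + k. ?g i)"
    by (intro sum_mono multiplicity_2_lucas_le)
  also have "\<dots> \<le> (\<Sum>i = n..n + 6. ?g i)"
    using assms by (intro sum_mono2) auto
  also have "\<dots> \<le> 5"
  proof -
    define q where "q = n div 6"
    have "n = 6 * q \<or> n = 6 * q + 1 \<or> n = 6 * q + 2 \<or> n = 6 * q + 3
        \<or> n = 6 * q + 4 \<or> n = 6 * q + 5"
      unfolding q_def by presburger
    then show ?thesis
      unfolding atLeastAtMost_add_6 by (elim disjE) (simp_all del: add_2_eq_Suc add_2_eq_Suc')
  qed
  finally show ?thesis .
qed

section \<open>Order of appearance of the product\<close>

text \<open>Isolates the prime 3 as the only obstruction beyond \<open>a dvd m\<close>. The converse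
  direction compares valuations at 2, at 3 and at the remaining primes.\<close>

lemma prod_lucas_dvd_fib_iff:
  fixes n k m :: nat
  assumes n: "1 \<le> n" and k: "3 \<le> k" "k \<le> 6" and m: "0 < m"
  defines "a \<equiv> 2 * Lcm {n..n + k}" and "b \<equiv> (\<Prod>i = n..n + k. lucas i)"
  shows "b dvd fib m \<longleftrightarrow> a dvd m \<and> multiplicity 3 b \<le> Suc (multiplicity 3 m)"
proof -
  have double_dvd_a: "2 * i dvd a" if "i \<in> {n..n + k}" for i
    using that unfolding a_def by (intro mult_dvd_mono dvd_Lcm) auto
  have four_dvd_a: "4 dvd a"
  proof -
    have "even n \<or> even (n + 1)"
      by presburger
    then have "4 dvd 2 * n \<or> 4 dvd 2 * (n + 1)"
      by presburger
    with double_dvd_a[of n] double_dvd_a[of "n + 1"] k show ?thesis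
      by (auto intro: dvd_trans)
  qed
  have three_m: "multiplicity 3 (fib m) = Suc (multiplicity 3 m)" if "a dvd m"
  proof -
    have "4 dvd m"
      using four_dvd_a that by (rule dvd_trans)
    then obtain l where l: "m = 4 * l"
      by blast
    show ?thesis
      using multiplicity_3_double[of l] multiplicity_3_double[of "2 * l"] m l multiplicity_3_fib[of l] by simp
  qed
  have fib_m: "fib m \<noteq> 0"
    using m fib_neq_0_nat by simp
  show ?thesis
  proof (intro iffI conjI; (elim conjE)?)
    assume b: "b dvd fib m"
    have double_dvd: "2 * i dvd m" if "i \<in> {n..n + k}" for i
    proof (cases "2 \<le> i")
      case True
      have "lucas i dvd b"
        unfolding b_def using that by (intro dvd_prodI) auto
      with b have "lucas i dvd fib m"
        by (rule dvd_trans[rotated])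
      with True show ?thesis
        by (rule double_dvd_if_lucas_dvd_fib)
    next
      case False
      \<comment> \<open>L_1 = 1 carries no information, so the neighbouring factor L_2 = 3 is used:
        it yields 4 | m.\<close>
      with n that have "n = 1" "i = 1"
        by auto
      moreover have "lucas 2 dvd b"
        unfolding b_def using k \<open>n = 1\<close> by (intro dvd_prodI) auto
      with b have "lucas 2 dvd fib m"
        by (rule dvd_trans[rotated])
      then have "2 * 2 dvd m"
        by (intro double_dvd_if_lucas_dvd_fib) auto
      ultimately show ?thesis
        by (auto elim: dvd_trans[rotated])
    qed
    have "even m"
      using double_dvd[of n] by (auto elim: dvd_mult_left)
    then obtain l where l: "m = 2 * l"
      by blast
    have "Lcm {n..n + k} dvd l"
      using double_dvd unfolding l by (intro Lcm_least) auto
    then show "a dvd m"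
      by (simp add: a_def l)
    with b fib_m show "multiplicity 3 b \<le> Suc (multiplicity 3 m)"
      by (metis dvd_imp_multiplicity_le three_m)
  next
    assume a: "a dvd m" and three: "multiplicity 3 b \<le> Suc (multiplicity 3 m)"
    have lucas_dvd: "lucas i dvd fib m" if "i \<in> {n..n + k}" for i
      using double_dvd_a[OF that] a fib_dvd lucas_dvd_fib_double by (meson dvd_trans)
    have b_pos: "b \<noteq> 0"
      by (auto simp: b_def)
    have "32 dvd fib m"
    proof -
      have "8 dvd a"
      proof -
        \<comment> \<open>Four consecutive indices contain a multiple of 4; the factor 2 in
          \<open>a\<close> raises this to 8.\<close>
        have "4 dvd n \<or> 4 dvd n + 1 \<or> 4 dvd n + 2 \<or> 4 dvd n + 3"
          by presburger
        then obtain i where "4 dvd i" "i \<in> {n..n + k}"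
          using k by fastforce
        then have "2 * 4 dvd 2 * i" "2 * i dvd a"
          using double_dvd_a by auto
        then show ?thesis
          by (auto intro: dvd_trans)
      qed
      moreover have "3 dvd a"
      proof -
        have "3 dvd n \<or> 3 dvd n + 1 \<or> 3 dvd n + 2"
          by presburger
        then obtain i where "3 dvd i" "i \<in> {n..n + k}"
          using k by fastforce
        then have "3 dvd 2 * i" "2 * i dvd a"
          using double_dvd_a by auto
        then show ?thesis
          by (auto intro: dvd_trans)
      qed
      ultimately have "24 dvd a"
        by presburger
      then have "fib 24 dvd fib m"
        using a by (intro fib_dvd) (rule dvd_trans)
      moreover have "32 dvd fib 24"
        by (simp add: fib_numerals)
      ultimately show ?thesis
        by (rule dvd_trans[rotated])
    qed
    then have two: "5 \<le> multiplicity 2 (fib m)"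
      using fib_m by (intro multiplicity_geI) auto
    show "b dvd fib m"
    proof (rule multiplicity_le_imp_dvd[OF b_pos])
      fix p :: nat
      assume p: "prime p"
      consider "p = 2" | "p = 3" | "p \<notin> {2, 3}"
        by blast
      then show "multiplicity p b \<le> multiplicity p (fib m)"
      proof cases
        case 1
        with two multiplicity_2_prod_lucas_le[OF k(2), of n] show ?thesis
          by (simp add: b_def)
      next
        case 2
        with three three_m[OF a] show ?thesis
          by simp
      next
        case 3
        have sum: "multiplicity p b = (\<Sum>i = n..n + k. multiplicity p (lucas i))"
          unfolding b_def using p by (intro prime_elem_multiplicity_prod_distrib) auto
        show ?thesis
        proof (cases "\<exists>i\<in>{n..n + k}. p dvd lucas i")
          case True
          then obtain i where i: "i \<in> {n..n + k}" "p dvd lucas i"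
            by blast
          \<comment> \<open>Only one factor is divisible by p, so the whole p-part of
            \<open>b\<close> sits in L_i, which divides F_m.\<close>
          have "\<not> p dvd lucas j" if j: "j \<in> {n..n + k}" "j \<noteq> i" for j
          proof
            assume "p dvd lucas j"
            moreover have "j - i \<le> 6" "i - j \<le> 6"
              using i j k(2) by auto
            ultimately show False using i 3 j p prime_dvd_two_lucas[of p i "j - i"] prime_dvd_two_lucas[of p j "i - j"]
              by (cases "i < j") auto
          qed
          then have "(\<Sum>j\<in>{n..n + k} - {i}. multiplicity p (lucas j)) = 0"
            by (auto intro!: sum.neutral not_dvd_imp_multiplicity_0)
          then have "multiplicity p b = multiplicity p (lucas i)"
            unfolding sum using i by (simp add: sum.remove)
          with lucas_dvd i fib_m show ?thesis
            by (simp add: dvd_imp_multiplicity_le)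
        next
          case False
          then have "multiplicity p b = 0"
            unfolding sum by (auto intro!: sum.neutral not_dvd_imp_multiplicity_0)
          then show ?thesis
            by simp
        qed
      qed
    qed
  qed
qed

text \<open>The order is the least positive multiple m of \<open>a\<close> whose 3-adic valuation is
  large enough. If \<open>a\<close> falls short, it does so by exactly 1; then 2a fails too, having
  the same valuation, and 3a succeeds.\<close>

lemma fib_appearance_prod_lucas:
  fixes n k :: nat
  assumes "1 \<le> n" "3 \<le> k" "k \<le> 6"
  defines "a \<equiv> 2 * Lcm {n..n + k}" and "b \<equiv> (\<Prod>i = n..n + k. lucas i)"
  assumes "multiplicity 3 b \<le> Suc (Suc (multiplicity 3 a))"
  shows "fib_appearance b = (if multiplicity 3 b \<le> Suc (multiplicity 3 a) then a else 3 * a)"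
proof -
  note iff = prod_lucas_dvd_fib_iff[OF assms(1-3), folded a_def b_def]
  have a: "0 < a"
    using assms(1) by (auto simp: a_def Lcm_0_iff_nat intro!: gr0I)
  show ?thesis
  proof (cases "multiplicity 3 b \<le> Suc (multiplicity 3 a)")
    case True
    have "fib_appearance b = a"
      unfolding fib_appearance_def
      using a True by (intro Least_equality) (auto simp: iff dvd_imp_le)
    with True show ?thesis
      by simp
  next
    case False
    have "fib_appearance b = 3 * a"
      unfolding fib_appearance_def
    proof (intro Least_equality conjI)
      show "b dvd fib (3 * a)"
        using a assms(6) by (simp add: iff multiplicity_times_same)
      fix m
      assume "0 < m \<and> b dvd fib m"
      then have m: "0 < m" "a dvd m" "multiplicity 3 b \<le> Suc (multiplicity 3 m)"
        by (auto simp: iff)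
      then obtain c where c: "m = a * c" by blast
      have "c \<noteq> 0" "c \<noteq> 1" "c \<noteq> 2"
      proof -
        show "c \<noteq> 0" using m(1) c by auto
        show "c \<noteq> 1" using m(3) c False by auto
        show "c \<noteq> 2"
          using m(3) c False multiplicity_3_double[of a] by (auto simp: mult.commute)
      qed
      then have "3 \<le> c" by auto
      then show "3 * a \<le> m"
        by (simp add: c mult.commute)
    qed (use a in auto)
    with False show ?thesis
      by simp
  qed
qed

section \<open>Reduction to residues modulo 36\<close>

text \<open>Seven consecutive numbers contain at most one multiple of 9, so a single unknown t
  describes all their valuations.\<close>

lemma multiplicity_3_window:
  fixes n :: nat
  assumes "0 < n"
  obtains t where "2 \<le> t"
    "\<And>i. i \<le> 6 \<Longrightarrow> multiplicity 3 (n + i)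
      = (if (n + i) mod 3 \<noteq> 0 then 0 else if (n + i) mod 9 \<noteq> 0 then 1 else t)"
proof -
  have le_1: "multiplicity 3 x = (if x mod 3 \<noteq> 0 then 0 else 1)" if "x mod 9 \<noteq> 0" for x :: nat
    using that by (auto intro!: not_dvd_imp_multiplicity_0 multiplicity_eqI)
  show thesis
  proof (cases "\<exists>j\<le>6. 9 dvd n + j")
    case True
    then obtain j where j: "j \<le> 6" "9 dvd n + j"
      by blast
    show thesis
    proof (rule that[of "multiplicity 3 (n + j)"])
      show "2 \<le> multiplicity 3 (n + j)"
        using j assms by (intro multiplicity_geI) auto
      fix i :: nat
      assume i: "i \<le> 6"
      have "i = j" if "(n + i) mod 9 = 0"
        using i j that by presburger
      moreover have "x mod 9 = 0 \<Longrightarrow> x mod 3 = 0" for x :: nat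
        by presburger
      ultimately show "multiplicity 3 (n + i) = (if (n + i) mod 3 \<noteq> 0 then 0
          else if (n + i) mod 9 \<noteq> 0 then 1 else multiplicity 3 (n + j))"
        using le_1[of "n + i"] by auto
    qed
  next
    case False
    show thesis
    \<comment> \<open>Without a multiple of 9 the value t never occurs; 2 merely meets the lower
      bound.\<close>
    proof (rule that[of 2])
      show "multiplicity 3 (n + i)
          = (if (n + i) mod 3 \<noteq> 0 then 0 else if (n + i) mod 9 \<noteq> 0 then 1 else 2)" if "i \<le> 6" for i
        using le_1[of "n + i"] False that by (auto simp: mod_eq_0_iff_dvd)
    qed simp
  qed
qed


lemma atLeastAtMost_0_numerals:
  "{0..4 :: nat} = {0, 1, 2, 3, 4}"
  "{0..5 :: nat} = {0, 1, 2, 3, 4, 5}"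
  "{0..6 :: nat} = {0, 1, 2, 3, 4, 5, 6}"
  by auto

text \<open>
  With \<open>r\<close> the residue of \<open>n\<close> modulo 36, \<open>window_val t r i\<close> is \<open>v\<^sub>3(n + i)\<close>, where \<open>t\<close> stands for
  the valuation of the multiple of 9 among the indices, if there is one.
\<close>
definition window_val :: "nat \<Rightarrow> nat \<Rightarrow> nat \<Rightarrow> nat" where
  "window_val t r i = (if (r + i) mod 3 \<noteq> 0 then 0 else if (r + i) mod 9 \<noteq> 0 then 1 else t)"

text \<open>Here s stands for v_3(b) and M for v_3(a). Quantifying over every t \<ge> 2 leaves 36
  cases with a symbolic t.\<close>

definition excess_residues :: "nat \<Rightarrow> nat set \<Rightarrow> bool" where
  "excess_residues k S \<longleftrightarrow> (\<forall>r\<in>{..<36}. \<forall>t\<ge>2.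
    let s = \<Sum>i = 0..k. if (r + i) mod 4 = 2 then Suc (window_val t r i) else 0;
        M = Max (window_val t r ` {0..k})
    in if r \<in> S then s = Suc (Suc M) else s \<le> Suc M)"

lemma lessThan_36:
  "{..<36 :: nat} = {0, 1, 2, 3, 4, 5, 6, 7, 8, 9, 10, 11, 12, 13, 14, 15, 16, 17,
    18, 19, 20, 21, 22, 23, 24, 25, 26, 27, 28, 29, 30, 31, 32, 33, 34, 35}"
proof (rule Set.set_eqI)
  fix r :: nat
  show "r \<in> {..<36} \<longleftrightarrow> r \<in> {0, 1, 2, 3, 4, 5, 6, 7, 8, 9, 10, 11, 12, 13, 14, 15, 16, 17,
    18, 19, 20, 21, 22, 23, 24, 25, 26, 27, 28, 29, 30, 31, 32, 33, 34, 35}"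
    unfolding lessThan_iff insert_iff empty_iff by presburger
qed

lemma excess_residues_4: "excess_residues 4 {2, 14, 18, 30}"
  unfolding excess_residues_def lessThan_36 ball_simps atLeastAtMost_0_numerals
  by (intro conjI allI impI TrueI)
    (simp_all add: window_val_def Let_def del: One_nat_def add_2_eq_Suc add_2_eq_Suc')

lemma excess_residues_5: "excess_residues 5 {1, 2, 13, 14, 17, 18, 29, 30}"
  unfolding excess_residues_def lessThan_36 ball_simps atLeastAtMost_0_numerals
  by (intro conjI allI impI TrueI)
    (simp_all add: window_val_def Let_def del: One_nat_def add_2_eq_Suc add_2_eq_Suc')

lemma excess_residues_6: "excess_residues 6 {1, 2, 12, 13, 14, 16, 17, 18, 28, 29}"
  unfolding excess_residues_def lessThan_36 ball_simps atLeastAtMost_0_numerals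
  by (intro conjI allI impI TrueI)
    (simp_all add: window_val_def Let_def del: One_nat_def add_2_eq_Suc add_2_eq_Suc')

lemma fib_appearance_prod_lucas_eq:
  fixes n k :: nat and S :: "nat set"
  assumes n: "1 \<le> n" and k: "3 \<le> k" "k \<le> 6" and S: "excess_residues k S"
  defines "a \<equiv> 2 * Lcm {n..n + k}"
  shows "fib_appearance (\<Prod>i = n..n + k. lucas i) = (if n mod 36 \<in> S then 3 * a else a)"
proof -
  define b where "b = (\<Prod>i = n..n + k. lucas i)"
  obtain t where t: "2 \<le> t" and window: "\<And>i. i \<le> 6 \<Longrightarrow> multiplicity 3 (n + i)
      = (if (n + i) mod 3 \<noteq> 0 then 0 else if (n + i) mod 9 \<noteq> 0 then 1 else t)"
    using multiplicity_3_window[of n] n by auto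
  let ?v = "window_val t (n mod 36)"
  \<comment> \<open>Applied with d = 3, 9 and 4, the moduli that determine both valuations; all
    divide 36.\<close>
  have residue: "(n mod 36 + i) mod d = (n + i) mod d" if "d dvd 36" for d i
    using that by (metis mod_add_left_eq mod_mod_cancel)
  have v: "multiplicity 3 (n + i) = ?v i" if "i \<le> k" for i
    using that k window[of i] by (simp add: window_val_def residue)
  have image: "{n..n + k} = (+) n ` {0..k}"
    by simp
  have "multiplicity 3 a = multiplicity 3 (Lcm {n..n + k})"
    unfolding a_def by (rule multiplicity_3_double)
  also have "\<dots> = Max (multiplicity 3 ` {n..n + k})"
    using n prime_elem_3 by (intro multiplicity_Lcm) (auto simp: prime_elem_iff_prime_abs)
  also have "\<dots> = Max (?v ` {0..k})"
    unfolding image image_image using v by simp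
  finally have three_a: "multiplicity 3 a = Max (?v ` {0..k})" .
  have "multiplicity 3 b = (\<Sum>i = n..n + k. if i mod 4 = 2 then Suc (multiplicity 3 i) else 0)"
    unfolding b_def using n by (intro multiplicity_3_prod_lucas) auto
  also have "\<dots> = (\<Sum>i = 0..k. if (n + i) mod 4 = 2 then Suc (multiplicity 3 (n + i)) else 0)"
    unfolding image by (subst sum.reindex) simp_all
  also have "\<dots> = (\<Sum>i = 0..k. if (n mod 36 + i) mod 4 = 2 then Suc (?v i) else 0)"
    using v by (intro sum.cong) (simp_all add: residue)
  finally have three_b:
    "multiplicity 3 b = (\<Sum>i = 0..k. if (n mod 36 + i) mod 4 = 2 then Suc (?v i) else 0)" .
  have "n mod 36 \<in> {..<36}"
    by simp
  from bspec[OF S[unfolded excess_residues_def Let_def] this] t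
  have "if n mod 36 \<in> S then multiplicity 3 b = Suc (Suc (multiplicity 3 a))
      else multiplicity 3 b \<le> Suc (multiplicity 3 a)"
    unfolding three_a three_b by blast
  then show ?thesis
    using fib_appearance_prod_lucas[OF n k, folded a_def b_def]
    unfolding b_def[symmetric] by (cases "n mod 36 \<in> S") simp_all
qed

theorem theorem4p5:
  fixes n k a b :: nat
  assumes "n \<ge> 1"
    and "k \<in> {4, 5, 6}"
    and "a = 2 * Lcm {n..n + k}"
    and "b = (\<Prod>i = n..n + k. lucas i)"
  shows "(k = 4 \<longrightarrow>
            fib_appearance b =
              (if n mod 36 \<in> {2, 14, 18, 30} then 3 * a else a))
       \<and> (k = 5 \<longrightarrow>
            fib_appearance b =
              (if n mod 36 \<in> {1, 2, 13, 14, 17, 18, 29, 30} then 3 * a else a))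
       \<and> (k = 6 \<longrightarrow>
            fib_appearance b =
              (if n mod 36 \<in> {1, 2, 12, 13, 14, 16, 17, 18, 28, 29} then 3 * a else a))"
proof -
  have "k = 4 \<Longrightarrow> fib_appearance b = (if n mod 36 \<in> {2, 14, 18, 30} then 3 * a else a)"
    and "k = 5 \<Longrightarrow> fib_appearance b
      = (if n mod 36 \<in> {1, 2, 13, 14, 17, 18, 29, 30} then 3 * a else a)"
    and "k = 6 \<Longrightarrow> fib_appearance b
      = (if n mod 36 \<in> {1, 2, 12, 13, 14, 16, 17, 18, 28, 29} then 3 * a else a)"
    unfolding assms(3,4) using assms(1)
    by (intro fib_appearance_prod_lucas_eq;
        simp only: excess_residues_4 excess_residues_5 excess_residues_6)+
  then show ?thesis
    by blast
qed

end
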